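(* Let $C$ be the set of rational Cauchy sequences with the relations $\sim$, $<$ and $\lesssim$ defined in the context. Let $B\subset C$ be a nonempty set for which there is some $(a_n)\in C$ such that $(b_n)\lesssim(a_n)$ for every $(b_n)\in B$. Then $B$ has a least upper bound, that is, there exists a sequence $(a_n')\in C$, unique up to $\sim$, such that (i) $(b_n)\lesssim(a_n')$ for every $(b_n)\in B$, and (ii) for every $(c_n)\in C$ with $(c_n)<(a_n')$ there is a $(b_n)\in B$ with $(c_n)<(b_n)$.
   Context: Here $\mathbb{N}=\{1,2,3,\dots\}$, and $k,m,n,n_0$ range over $\mathbb{N}$. A sequence $(a_n)=(a_n)_{n\in\mathbb{N}}$ in $\mathbb{Q}$ is Cauchy if $\forall k\,\exists n_0\,(m,n\ge n_0\Rightarrow |a_m-a_n|\le 1/k)$. Let $C$ be the set of all Cauchy sequences in $\mathbb{Q}$ (no quotient is taken). On $C$ define the equivalence relation $(a_n)\sim(b_n)\iff \forall k\,\exists n_0\,(n\ge n_0\Rightarrow |a_n-b_n|\le 1/k)$ and the relation $(a_n)<(b_n)\iff \exists k\,\exists n_0\,(n\ge n_0\Rightarrow a_n<b_n-1/k)$. The notation $(a_n)\lesssim(b_n)$ means that $(a_n)<(b_n)$ or $(a_n)\sim(b_n)$. "Unique up to $\sim$" means that any two sequences in $C$ satisfying both (i) and (ii) are related by $\sim$. *)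

theory Defs
  imports Complex_Main
begin

text \<open>
  Sequences are indexed by the positive integers: all indices below are at least 1,
  so the value of a function at 0 is never inspected.
\<close>

definition cauchy_seqs :: "(nat \<Rightarrow> rat) set" where
  "cauchy_seqs = {a. \<forall>k\<ge>1. \<exists>n0\<ge>1. \<forall>m\<ge>n0. \<forall>n\<ge>n0. \<bar>a m - a n\<bar> \<le> 1 / of_nat k}"

definition seq_equiv :: "(nat \<Rightarrow> rat) \<Rightarrow> (nat \<Rightarrow> rat) \<Rightarrow> bool" (infix "\<sim>" 50) where
  "a \<sim> b \<longleftrightarrow> (\<forall>k\<ge>1. \<exists>n0\<ge>1. \<forall>n\<ge>n0. \<bar>a n - b n\<bar> \<le> 1 / of_nat k)"

definition seq_less :: "(nat \<Rightarrow> rat) \<Rightarrow> (nat \<Rightarrow> rat) \<Rightarrow> bool" (infix "\<prec>" 50) where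
  "a \<prec> b \<longleftrightarrow> (\<exists>k\<ge>1. \<exists>n0\<ge>1. \<forall>n\<ge>n0. a n < b n - 1 / of_nat k)"

definition seq_lesssim :: "(nat \<Rightarrow> rat) \<Rightarrow> (nat \<Rightarrow> rat) \<Rightarrow> bool" (infix "\<lesssim>" 50) where
  "a \<lesssim> b \<longleftrightarrow> a \<prec> b \<or> a \<sim> b"

definition is_seq_lub :: "(nat \<Rightarrow> rat) set \<Rightarrow> (nat \<Rightarrow> rat) \<Rightarrow> bool" where
  "is_seq_lub B a \<longleftrightarrow>
     (\<forall>b\<in>B. b \<lesssim> a) \<and>
     (\<forall>c\<in>cauchy_seqs. c \<prec> a \<longrightarrow> (\<exists>b\<in>B. c \<prec> b))"

end

theory Submission
  imports Defs
begin

text \<open>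
  Under the embedding of the rationals into the reals, every element of \<open>C\<close> has a real limit,
  every real number arises in this way, and \<open>\<sim>\<close>, \<open>\<prec>\<close>, \<open>\<lesssim>\<close> become
  \<open>=\<close>, \<open><\<close>, \<open>\<le>\<close> between the limits. The least upper bound is then any rational sequence
  converging to the supremum of the limits of the members of \<open>B\<close>.
\<close>

abbreviation rat_tendsto :: "(nat \<Rightarrow> rat) \<Rightarrow> real \<Rightarrow> bool" where
  "rat_tendsto a x \<equiv> (\<lambda>n. real_of_rat (a n)) \<longlonglongrightarrow> x"

text \<open>\<open>of_rat\<close> is an order embedding that respects the field operations. Used as
  a rewrite rule, this turns the rational estimates in the definitions of \<open>cauchy_seqs\<close>
  and \<open>\<sim>\<close> into real ones.\<close>

lemma abs_rat_le_inverse_iff: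
  "\<bar>p - q\<bar> \<le> 1 / of_nat k \<longleftrightarrow> \<bar>real_of_rat p - real_of_rat q\<bar> \<le> 1 / real k"
proof -
  have "real_of_rat \<bar>p - q\<bar> \<le> real_of_rat (1 / of_nat k) \<longleftrightarrow> \<bar>p - q\<bar> \<le> 1 / of_nat k"
    by (simp only: of_rat_less_eq)
  then show ?thesis
    by (simp add: of_rat_divide flip: of_rat_diff)
qed

lemma rat_less_diff_inverse_iff:
  "p < q - 1 / of_nat k \<longleftrightarrow> real_of_rat p < real_of_rat q - 1 / real k"
proof -
  have "real_of_rat p < real_of_rat (q - 1 / of_nat k) \<longleftrightarrow> p < q - 1 / of_nat k"
    by (simp only: of_rat_less)
  then show ?thesis
    by (simp add: of_rat_divide of_rat_diff)
qed

lemma ex_inverse_nat_less: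
  fixes e :: real
  assumes "0 < e"
  obtains k :: nat where "k \<ge> 1" "1 / real k < e"
proof -
  from assms obtain n :: nat where "n \<noteq> 0" "inverse (real n) < e"
    using real_arch_inverse by blast
  then show thesis
    by (intro that[of n]) (auto simp: inverse_eq_divide)
qed

text \<open>By the Archimedean property, the tolerances 1/k express the same condition as arbitrary
  real e > 0, so membership is the usual Cauchy property of the embedded sequence. Completeness of
  the reals then supplies the limit.\<close>

lemma cauchy_seqs_iff_convergent:
  "a \<in> cauchy_seqs \<longleftrightarrow> (\<exists>x. rat_tendsto a x)"
proof -
  have "a \<in> cauchy_seqs \<longleftrightarrow> Cauchy (\<lambda>n. real_of_rat (a n))"
  proof
    assume a: "a \<in> cauchy_seqs"
    show "Cauchy (\<lambda>n. real_of_rat (a n))"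
    proof (rule CauchyI)
      fix e :: real
      assume "0 < e"
      then obtain k :: nat where k: "k \<ge> 1" "1 / real k < e"
        by (rule ex_inverse_nat_less)
      with a obtain n0 where "\<forall>m\<ge>n0. \<forall>n\<ge>n0. \<bar>a m - a n\<bar> \<le> 1 / of_nat k"
        unfolding cauchy_seqs_def by blast
      then show "\<exists>M. \<forall>m\<ge>M. \<forall>n\<ge>M. norm (real_of_rat (a m) - real_of_rat (a n)) < e"
        using k(2) unfolding abs_rat_le_inverse_iff real_norm_def
        by (meson le_less_trans)
    qed
  next
    assume c: "Cauchy (\<lambda>n. real_of_rat (a n))"
    have "\<exists>n0\<ge>1. \<forall>m\<ge>n0. \<forall>n\<ge>n0. \<bar>real_of_rat (a m) - real_of_rat (a n)\<bar> \<le> 1 / real k"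
      if "k \<ge> 1" for k :: nat
    proof -
      from that have "0 < 1 / real k" by simp
      from CauchyD[OF c this] obtain M
        where "\<forall>m\<ge>M. \<forall>n\<ge>M. \<bar>real_of_rat (a m) - real_of_rat (a n)\<bar> < 1 / real k"
        by auto
      \<comment> \<open>The maximum with 1 is taken because the definition asks for a threshold of
        at least 1.\<close>
      then show ?thesis
        by (intro exI[of _ "max 1 M"]) (auto intro: less_imp_le)
    qed
    then show "a \<in> cauchy_seqs"
      unfolding cauchy_seqs_def abs_rat_le_inverse_iff by blast
  qed
  then show ?thesis
    by (simp add: Cauchy_convergent_iff convergent_def)
qed

lemma seq_equiv_iff_limits_eq:
  assumes a: "rat_tendsto a x" and b: "rat_tendsto b y"
  shows "a \<sim> b \<longleftrightarrow> x = y"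
proof
  assume ab: "a \<sim> b"
  \<comment> \<open>The summand 0 gives the bound the shape that \<open>field_le_epsilon\<close>
    expects.\<close>
  have "\<bar>x - y\<bar> \<le> 0 + e" if "0 < e" for e
  proof -
    from that obtain k :: nat where k: "k \<ge> 1" "1 / real k < e"
      by (rule ex_inverse_nat_less)
    with ab obtain n0 where
      n0: "\<forall>n\<ge>n0. \<bar>real_of_rat (a n) - real_of_rat (b n)\<bar> \<le> 1 / real k"
      unfolding seq_equiv_def abs_rat_le_inverse_iff by blast
    have "(\<lambda>n. \<bar>real_of_rat (a n) - real_of_rat (b n)\<bar>) \<longlonglongrightarrow> \<bar>x - y\<bar>"
      using a b by (intro tendsto_intros)
    then have "\<bar>x - y\<bar> \<le> 1 / real k"
      using n0 by (intro LIMSEQ_le_const2) auto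
    with k show ?thesis by linarith
  qed
  then have "\<bar>x - y\<bar> \<le> 0"
    by (rule field_le_epsilon)
  then show "x = y" by simp
next
  assume "x = y"
  then have d: "(\<lambda>n. real_of_rat (a n) - real_of_rat (b n)) \<longlonglongrightarrow> 0"
    using tendsto_diff[OF a b] by simp
  have "\<exists>n0\<ge>1. \<forall>n\<ge>n0. \<bar>real_of_rat (a n) - real_of_rat (b n)\<bar> \<le> 1 / real k"
    if "k \<ge> 1" for k :: nat
  proof -
    from that have "0 < 1 / real k" by simp
    from LIMSEQ_D[OF d this] obtain M
      where "\<forall>n\<ge>M. \<bar>real_of_rat (a n) - real_of_rat (b n)\<bar> < 1 / real k"
      by auto
    then show ?thesis
      by (intro exI[of _ "max 1 M"]) (auto intro: less_imp_le)
  qed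
  then show "a \<sim> b"
    unfolding seq_equiv_def abs_rat_le_inverse_iff by blast
qed

text \<open>Strict inequalities weaken to \<open>\<le>\<close> in the limit, but the uniform gap 1/k
  in \<open>\<prec>\<close> survives and keeps x and y apart. Conversely, any 1/k below y - x is
  eventually a gap between the sequences.\<close>

lemma seq_less_iff_limits_less:
  assumes a: "rat_tendsto a x" and b: "rat_tendsto b y"
  shows "a \<prec> b \<longleftrightarrow> x < y"
proof
  assume "a \<prec> b"
  then obtain k n0 :: nat where k: "k \<ge> 1"
    and n0: "\<forall>n\<ge>n0. real_of_rat (a n) < real_of_rat (b n) - 1 / real k"
    unfolding seq_less_def rat_less_diff_inverse_iff by blast
  have "(\<lambda>n. real_of_rat (b n) - 1 / real k) \<longlonglongrightarrow> y - 1 / real k"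
    using b by (intro tendsto_intros)
  with a have "x \<le> y - 1 / real k"
    by (rule LIMSEQ_le) (use n0 less_imp_le in blast)
  moreover have "0 < 1 / real k" using k by simp
  ultimately show "x < y" by linarith
next
  assume "x < y"
  then obtain k :: nat where k: "k \<ge> 1" "1 / real k < y - x"
    using ex_inverse_nat_less[of "y - x"] by auto
  have "(\<lambda>n. real_of_rat (b n) - real_of_rat (a n)) \<longlonglongrightarrow> y - x"
    using a b by (intro tendsto_intros)
  from order_tendstoD(1)[OF this k(2)] obtain M
    where "\<forall>n\<ge>M. 1 / real k < real_of_rat (b n) - real_of_rat (a n)"
    unfolding eventually_sequentially by blast
  then have "\<forall>n\<ge>max 1 M. real_of_rat (a n) < real_of_rat (b n) - 1 / real k"
    by (simp add: algebra_simps)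
  then show "a \<prec> b"
    unfolding seq_less_def rat_less_diff_inverse_iff using k(1) max.cobounded1 by blast
qed

lemma seq_lesssim_iff_limits_le:
  assumes "rat_tendsto a x" and "rat_tendsto b y"
  shows "a \<lesssim> b \<longleftrightarrow> x \<le> y"
  using seq_less_iff_limits_less[OF assms] seq_equiv_iff_limits_eq[OF assms]
  by (auto simp: seq_lesssim_def)

text \<open>Density of the rationals gives terms squeezed between x and a bound that decreases to
  x.\<close>

lemma ex_rat_tendsto:
  obtains a where "rat_tendsto a x"
proof -
  \<comment> \<open>With n in place of \<open>Suc n\<close> the interval would be empty at n = 0,
    since 1 / 0 = 0.\<close>
  have "\<exists>q. x < real_of_rat q \<and> real_of_rat q < x + 1 / real (Suc n)" for n
    by (rule of_rat_dense) simp
  then obtain a where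
    a: "\<And>n. x < real_of_rat (a n) \<and> real_of_rat (a n) < x + 1 / real (Suc n)"
    by metis
  have "(\<lambda>n. x + 1 / real (Suc n)) \<longlonglongrightarrow> x + 0"
    by (intro tendsto_intros LIMSEQ_Suc[OF lim_1_over_n])
  then have "(\<lambda>n. x + 1 / real (Suc n)) \<longlonglongrightarrow> x"
    by simp
  then have "rat_tendsto a x"
    by (rule tendsto_sandwich[OF _ _ tendsto_const, rotated 2])
      (use a in \<open>auto intro!: always_eventually less_imp_le simp del: of_nat_Suc\<close>)
  then show thesis by (rule that)
qed

text \<open>Limits of Cauchy sequences c range over exactly the reals z, so condition (ii) becomes
  the approximation property of a real supremum.\<close>

lemma is_seq_lub_iff_limit:
  assumes lim: "\<And>b. b \<in> B \<Longrightarrow> rat_tendsto b (f b)" and a: "rat_tendsto a x"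
  shows "is_seq_lub B a \<longleftrightarrow> (\<forall>b\<in>B. f b \<le> x) \<and> (\<forall>z<x. \<exists>b\<in>B. z < f b)"
proof -
  have "(\<forall>b\<in>B. b \<lesssim> a) \<longleftrightarrow> (\<forall>b\<in>B. f b \<le> x)"
    using seq_lesssim_iff_limits_le[OF lim a] by blast
  moreover have "(\<forall>c\<in>cauchy_seqs. c \<prec> a \<longrightarrow> (\<exists>b\<in>B. c \<prec> b)) \<longleftrightarrow> (\<forall>z<x. \<exists>b\<in>B. z < f b)"
  proof (intro iffI allI impI ballI)
    fix z
    assume C: "\<forall>c\<in>cauchy_seqs. c \<prec> a \<longrightarrow> (\<exists>b\<in>B. c \<prec> b)" and "z < x"
    obtain c where c: "rat_tendsto c z" by (rule ex_rat_tendsto)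
    then have "c \<in> cauchy_seqs" "c \<prec> a"
      using cauchy_seqs_iff_convergent seq_less_iff_limits_less[OF c a] \<open>z < x\<close> by auto
    with C obtain b where "b \<in> B" "c \<prec> b" by blast
    then show "\<exists>b\<in>B. z < f b"
      using seq_less_iff_limits_less[OF c lim] by blast
  next
    fix c
    assume Z: "\<forall>z<x. \<exists>b\<in>B. z < f b" and "c \<in> cauchy_seqs" "c \<prec> a"
    then obtain z where c: "rat_tendsto c z"
      using cauchy_seqs_iff_convergent by blast
    with \<open>c \<prec> a\<close> Z obtain b where "b \<in> B" "z < f b"
      using seq_less_iff_limits_less[OF c a] by blast
    then show "\<exists>b\<in>B. c \<prec> b"
      using seq_less_iff_limits_less[OF c lim] by blast
  qed
  ultimately show ?thesis
    unfolding is_seq_lub_def by simp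
qed

theorem theorem3p5:
  fixes B :: "(nat \<Rightarrow> rat) set"
  assumes "B \<subseteq> cauchy_seqs"
    and "B \<noteq> {}"
    and "\<exists>a\<in>cauchy_seqs. \<forall>b\<in>B. b \<lesssim> a"
  shows "(\<exists>a'\<in>cauchy_seqs. is_seq_lub B a') \<and>
         (\<forall>a'\<in>cauchy_seqs. \<forall>a''\<in>cauchy_seqs.
            is_seq_lub B a' \<longrightarrow> is_seq_lub B a'' \<longrightarrow> a' \<sim> a'')"
proof -
  have "\<forall>b\<in>B. \<exists>x. rat_tendsto b x"
    using assms(1) cauchy_seqs_iff_convergent by blast
  then obtain f where f: "\<And>b. b \<in> B \<Longrightarrow> rat_tendsto b (f b)"
    by metis
  obtain a u where a: "rat_tendsto a u" and "\<forall>b\<in>B. b \<lesssim> a"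
    using assms(3) cauchy_seqs_iff_convergent by blast
  then have "\<forall>b\<in>B. f b \<le> u"
    using seq_lesssim_iff_limits_le[OF f a] by blast
  then have bdd: "bdd_above (f ` B)"
    by auto
  obtain s where s: "rat_tendsto s (Sup (f ` B))" by (rule ex_rat_tendsto)
  have "is_seq_lub B s"
    using assms(2) bdd
    by (subst is_seq_lub_iff_limit[OF f s]) (auto intro: cSUP_upper simp: less_cSUP_iff)
  moreover have "s \<in> cauchy_seqs"
    using s cauchy_seqs_iff_convergent by blast
  moreover have "a' \<sim> a''"
    if C: "a' \<in> cauchy_seqs" "a'' \<in> cauchy_seqs" and lub: "is_seq_lub B a'" "is_seq_lub B a''"
    for a' a''
  proof -
    obtain x y where x: "rat_tendsto a' x" and y: "rat_tendsto a'' y"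
      using C cauchy_seqs_iff_convergent by blast
    \<comment> \<open>If x < y, the approximation property of y at z = x yields b in
      \<open>B\<close> with x < \<open>f b\<close>, although x bounds all \<open>f b\<close>. The
      other case is symmetric.\<close>
    have "\<not> x < y" "\<not> y < x"
      using lub is_seq_lub_iff_limit[OF f x] is_seq_lub_iff_limit[OF f y]
      by (meson not_less)+
    then show ?thesis
      using seq_equiv_iff_limits_eq[OF x y] by linarith
  qed
  ultimately show ?thesis by blast
qed

end
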